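(* Let $W$ be a $v\times v$ (symmetric) positive definite matrix, regarded as a weight matrix, and let $R=(P_\tau W^{-1}P_\tau)^{+1/2}$. Then, given a design $\xi$ that is feasible for $R\tau$, the weighted information matrix $C_W(\xi)=W^{-1/2}C(\xi)W^{-1/2}$ has the same eigenvalues (including multiplicities) as the information matrix $N_R(\xi)=(R^TC^-(\xi)R)^+$ for $R\tau$.
   Context: Consider the linear model $y=X(\xi)\tau+L\beta+\varepsilon$, where $y\in\mathbb{R}^n$ is the response, $\tau\in\mathbb{R}^v$ is the vector of parameters of interest, $\beta\in\mathbb{R}^m$ is the vector of nuisance parameters, $\varepsilon$ satisfies $E(\varepsilon)=0$ and $\mathrm{Var}(\varepsilon)=I_n$, the design $\xi$ determines the matrix $X(\xi)$, and $L$ does not depend on $\xi$. The information matrix of $\xi$ for $\tau$ is the $v\times v$ non-negative definite matrix $C(\xi)=X^T(\xi)(I-P_L)X(\xi)$, where $P_L=L(L^TL)^-L^T$ is the orthogonal projector on the column space of $L$. Write $\mathcal{C}(A)$ for the column space of $A$, $A^+$ for the Moore-Penrose inverse, $A^{+1/2}=(A^+)^{1/2}$ for the non-negative definite square root of $A^+$ (for $A$ non-negative definite), and $A^-$ for any generalized inverse ($AA^-A=A$). A function $q^T\tau$ is estimable under $\xi$ iff $q\in\mathcal{C}(C(\xi))$. Standing assumption: all competing designs $\xi$ have the same estimation space, i.e. there is a fixed subspace $\mathcal{E}\subseteq\mathbb{R}^v$ with $\mathcal{C}(C(\xi))=\mathcal{E}$ for every $\xi$. $P_\tau$ is the $v\times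 v$ matrix of the orthogonal projection on $\mathcal{E}$. A design $\xi$ is feasible for a system $Q^T\tau$ if $\mathcal{C}(Q)\subseteq\mathcal{C}(C(\xi))$; the matrix $R$ is symmetric, so $R\tau=R^T\tau$. For a feasible $\xi$, $R^TC^-(\xi)R$ does not depend on the choice of generalized inverse. $W^{-1/2}$ is the inverse of the positive definite square root of $W$. *)

theory Defs
  imports "HOL-Analysis.Analysis" "HOL-Computational_Algebra.Polynomial"
begin

definition col_space :: "real^'n^'m \<Rightarrow> (real^'m) set" where
  "col_space A = span (columns A)"

definition nonneg_definite :: "real^'n^'n \<Rightarrow> bool" where
  "nonneg_definite A \<longleftrightarrow> transpose A = A \<and> (\<forall>x. 0 \<le> x \<bullet> (A *v x))"

definition pos_definite :: "real^'n^'n \<Rightarrow> bool" where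
  "pos_definite A \<longleftrightarrow> transpose A = A \<and> (\<forall>x. x \<noteq> 0 \<longrightarrow> 0 < x \<bullet> (A *v x))"

definition generalized_inverse :: "real^'n^'m \<Rightarrow> real^'m^'n \<Rightarrow> bool" where
  "generalized_inverse A G \<longleftrightarrow> A ** G ** A = A"

text \<open>The four Penrose equations determine the Moore--Penrose inverse uniquely.\<close>

definition is_pinv :: "real^'n^'m \<Rightarrow> real^'m^'n \<Rightarrow> bool" where
  "is_pinv A G \<longleftrightarrow> A ** G ** A = A \<and> G ** A ** G = G \<and>
     transpose (A ** G) = A ** G \<and> transpose (G ** A) = G ** A"

definition pinv :: "real^'n^'m \<Rightarrow> real^'m^'n" where
  "pinv A = (THE G. is_pinv A G)"

text \<open>The roots below are unique for a nonnegative definite (respectively positive definite)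
  argument and are used only for such arguments; otherwise their value is unspecified.\<close>

definition nnd_sqrt :: "real^'n^'n \<Rightarrow> real^'n^'n" where
  "nnd_sqrt A = (THE S. nonneg_definite S \<and> S ** S = A)"

definition pd_sqrt :: "real^'n^'n \<Rightarrow> real^'n^'n" where
  "pd_sqrt A = (THE S. pos_definite S \<and> S ** S = A)"

definition pinv_sqrt :: "real^'n^'n \<Rightarrow> real^'n^'n" where
  "pinv_sqrt A = nnd_sqrt (pinv A)"

definition inv_sqrt :: "real^'n^'n \<Rightarrow> real^'n^'n" where
  "inv_sqrt W = matrix_inv (pd_sqrt W)"

definition is_orth_proj :: "(real^'n) set \<Rightarrow> real^'n^'n \<Rightarrow> bool" where
  "is_orth_proj S P \<longleftrightarrow> (\<forall>x. P *v x \<in> S \<and> (\<forall>y\<in>S. orthogonal (x - P *v x) y))"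

definition orth_proj :: "(real^'n) set \<Rightarrow> real^'n^'n" where
  "orth_proj S = (THE P. is_orth_proj S P)"

text \<open>The projector below equals \<open>L (L\<^sup>T L)\<^sup>- L\<^sup>T\<close> for every generalized inverse of
  \<open>L\<^sup>T L\<close>; see lemma \<open>orth_proj_col_space\<close>.\<close>

definition info_matrix :: "real^'v^'n \<Rightarrow> real^'m^'n \<Rightarrow> real^'v^'v" where
  "info_matrix X L = transpose X ** (mat 1 - orth_proj (col_space L)) ** X"

text \<open>In the next definition \<open>C\<close> is the information matrix of a design for all parameters, and
  the linear system is \<open>Q\<^sup>T \<tau>\<close>.\<close>

definition feasible :: "real^'v^'v \<Rightarrow> real^'s^'v \<Rightarrow> bool" where
  "feasible C Q \<longleftrightarrow> col_space Q \<subseteq> col_space C"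

text \<open>The information matrix for \<open>Q\<^sup>T \<tau>\<close> is formed from a generalized inverse \<open>G\<close> of the
  information matrix of the design. The choice of \<open>G\<close> is immaterial for feasible designs,
  so it is kept as a parameter.\<close>

definition system_info_matrix :: "real^'v^'v \<Rightarrow> real^'s^'v \<Rightarrow> real^'s^'s" where
  "system_info_matrix G Q = pinv (transpose Q ** G ** Q)"

definition weighted_info_matrix :: "real^'v^'v \<Rightarrow> real^'v^'v \<Rightarrow> real^'v^'v" where
  "weighted_info_matrix W C = inv_sqrt W ** C ** inv_sqrt W"

definition charpoly :: "'a::comm_ring_1^'n^'n \<Rightarrow> 'a poly" where
  "charpoly A = det (mat [:0, 1:] - (\<chi> i j. [:A $ i $ j:]))"

text \<open>Taking complex roots makes this the complete spectrum, so that it always has as many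
  elements (with algebraic multiplicity) as the matrix has rows.\<close>

definition eigenvalues :: "real^'n^'n \<Rightarrow> complex multiset" where
  "eigenvalues A = proots (map_poly complex_of_real (charpoly A))"

lemma orth_proj_unique:
  assumes S: "subspace S" and P: "is_orth_proj S P" and Q: "is_orth_proj S Q"
  shows "P = Q"
proof -
  have "P *v x = Q *v x" for x
  proof -
    let ?d = "P *v x - Q *v x"
    have d: "?d \<in> S" using P Q S by (auto simp: is_orth_proj_def intro: subspace_diff)
    have "orthogonal (x - Q *v x) ?d" "orthogonal (x - P *v x) ?d"
      using P Q d by (auto simp: is_orth_proj_def)
    then have "?d \<bullet> ?d = 0" by (simp add: orthogonal_def inner_diff_left)
    then show ?thesis by simp
  qed
  then show ?thesis by (simp add: matrix_eq)
qed

lemma orth_proj_exists: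
  fixes S :: "(real^'n) set"
  assumes S: "subspace S"
  shows "\<exists>P. is_orth_proj S P"
proof -
  have "\<exists>y. y \<in> S \<and> (\<forall>w\<in>S. orthogonal (x - y) w)" for x
    by (rule orthogonal_subspace_decomp_exists[of S x])
      (metis S add_diff_cancel_left' span_eq_iff)
  then obtain f where f: "\<And>x. f x \<in> S" "\<And>x w. w \<in> S \<Longrightarrow> orthogonal (x - f x) w"
    by metis
  have uniq: "y = f x" if "y \<in> S" "\<And>w. w \<in> S \<Longrightarrow> orthogonal (x - y) w" for x y
  proof -
    have d: "y - f x \<in> S" using that f S by (auto intro: subspace_diff)
    have "orthogonal (x - y) (y - f x)" "orthogonal (x - f x) (y - f x)"
      using that(2) f(2) d by auto
    then have "(y - f x) \<bullet> (y - f x) = 0"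
      by (simp add: orthogonal_def inner_diff_left)
    then show ?thesis by simp
  qed
  have "linear f"
  proof
    show "f (a + b) = f a + f b" for a b
    proof (rule uniq[symmetric])
      show "f a + f b \<in> S" using f S by (auto intro: subspace_add)
      show "orthogonal (a + b - (f a + f b)) w" if "w \<in> S" for w
        using f(2)[OF that, of a] f(2)[OF that, of b]
        by (simp add: orthogonal_def algebra_simps)
    qed
    show "f (r *\<^sub>R b) = r *\<^sub>R f b" for r b
    proof (rule uniq[symmetric])
      show "r *\<^sub>R f b \<in> S" using f S by (auto intro: subspace_scale)
      show "orthogonal (r *\<^sub>R b - r *\<^sub>R f b) w" if "w \<in> S" for w
        using f(2)[OF that, of b]
        by (simp add: orthogonal_def algebra_simps)
    qed
  qed
  then have "is_orth_proj S (matrix f)"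
    using f by (simp add: is_orth_proj_def matrix_works)
  then show ?thesis by blast
qed

lemma orth_proj_eqI:
  "subspace S \<Longrightarrow> is_orth_proj S P \<Longrightarrow> orth_proj S = P"
  unfolding orth_proj_def by (rule the_equality) (auto intro: orth_proj_unique)

lemma is_orth_proj_orth_proj: "subspace S \<Longrightarrow> is_orth_proj S (orth_proj S)"
  using orth_proj_exists orth_proj_eqI by metis

lemma col_space_eq_range: "col_space A = range ((*v) A)"
proof
  have "column j A = A *v axis j 1" for j
    by (simp add: matrix_vector_mult_basis)
  then have "columns A \<subseteq> range ((*v) A)" by (auto simp: columns_def)
  moreover have "subspace (range ((*v) A))"
    by (rule linear_subspace_image) auto
  ultimately show "col_space A \<subseteq> range ((*v) A)"
    unfolding col_space_def by (rule span_minimal)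
  show "range ((*v) A) \<subseteq> col_space A"
    by (auto simp: col_space_def matrix_vector_mult_in_columnspace)
qed

lemma orth_proj_col_space:
  fixes L :: "real^'m^'n"
  assumes G: "generalized_inverse (transpose L ** L) G"
  shows "orth_proj (col_space L) = L ** G ** transpose L"
proof (rule orth_proj_eqI)
  show "subspace (col_space L)" by (simp add: col_space_def)
  let ?M = "transpose L ** L"
  have MG: "?M ** G ** ?M = ?M" using G by (simp add: generalized_inverse_def)
  have 1: "transpose L *v (x - (L ** G ** transpose L) *v x) = 0" for x
  proof -
    obtain y where y: "y \<in> col_space L" "\<And>w. w \<in> col_space L \<Longrightarrow> orthogonal (x - y) w"
      using is_orth_proj_orth_proj[of "col_space L"]
      by (auto simp: is_orth_proj_def col_space_def)
    obtain b where b: "y = L *v b" using y(1) by (auto simp: col_space_eq_range)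
    have "(transpose L *v (x - y)) \<bullet> w = 0" for w
      using y(2)[of "L *v w"]
      by (simp add: orthogonal_def col_space_eq_range dot_lmul_matrix)
    then have "transpose L *v (x - y) = 0" by (metis inner_eq_zero_iff)
    then have e: "transpose L *v x = ?M *v b"
      by (simp add: b matrix_vector_mult_diff_distrib matrix_vector_mul_assoc)
    have "transpose L *v ((L ** G ** transpose L) *v x) = (?M ** G) *v (transpose L *v x)"
      by (simp only: matrix_vector_mul_assoc matrix_mul_assoc)
    also have "\<dots> = (?M ** G ** ?M) *v b" by (simp only: e matrix_vector_mul_assoc)
    finally show ?thesis using e MG by (simp add: matrix_vector_mult_diff_distrib)
  qed
  show "is_orth_proj (col_space L) (L ** G ** transpose L)"
    unfolding is_orth_proj_def
  proof (intro allI conjI ballI)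
    fix x y
    show "(L ** G ** transpose L) *v x \<in> col_space L"
      by (simp add: col_space_eq_range flip: matrix_vector_mul_assoc)
    assume "y \<in> col_space L"
    then obtain w where "y = L *v w" by (auto simp: col_space_eq_range)
    then show "orthogonal (x - (L ** G ** transpose L) *v x) y"
      using 1[of x] by (metis dot_lmul_matrix inner_zero_left orthogonal_def transpose_matrix_vector)
  qed
qed

end

theory Submission
  imports Defs
begin

text \<open>Put \<open>M = P\<^sub>\<tau> W\<^sup>-\<^sup>1 P\<^sub>\<tau>\<close> and let \<open>S\<close> be its nonnegative definite square root, so that \<open>R\<close>
  is the Moore--Penrose inverse of \<open>S\<close> and \<open>R S = S R = P\<^sub>\<tau>\<close>, because \<open>M\<close> has column space
  \<open>\<E>\<close>. The Penrose equations then give \<open>(R C\<^sup>- R)\<^sup>+ = S C S\<close>. As \<open>A B\<close> and \<open>B A\<close> have the same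
  characteristic polynomial and \<open>P\<^sub>\<tau> C = C = C P\<^sub>\<tau>\<close>, the matrices \<open>S C S\<close>, \<open>C S\<^sup>2 = C W\<^sup>-\<^sup>1 P\<^sub>\<tau>\<close>,
  \<open>C W\<^sup>-\<^sup>1\<close> and \<open>W\<^sup>-\<^sup>1\<^sup>/\<^sup>2 C W\<^sup>-\<^sup>1\<^sup>/\<^sup>2\<close> all have the same eigenvalues.\<close>

section \<open>Orthonormal eigenbases\<close>

text \<open>A maximizer \<open>v\<close> of the quadratic form \<open>x \<bullet> f x\<close> on the
  unit sphere of \<open>S\<close> is an eigenvector: otherwise moving along the residual
  \<open>\<mu> *\<^sub>R v - f v\<close> would violate the maximality.\<close>

lemma selfadjoint_eigenvector:
  fixes f :: "'a::euclidean_space \<Rightarrow> 'a"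
  assumes f: "linear f" and sa: "\<And>x y. f x \<bullet> y = x \<bullet> f y"
    and S: "subspace S" and inv: "\<And>x. x \<in> S \<Longrightarrow> f x \<in> S" and ne: "S \<noteq> {0}"
  obtains v \<mu> where "v \<in> S" "norm v = 1" "f v = \<mu> *\<^sub>R v"
proof -
  obtain u where u: "u \<in> S" "u \<noteq> 0" using ne subspace_0[OF S] by blast
  have "u /\<^sub>R norm u \<in> sphere 0 1 \<inter> S" using u S by (auto intro: subspace_scale)
  then have "sphere 0 1 \<inter> S \<noteq> {}" by blast
  moreover have "compact (sphere 0 1 \<inter> S)" using closed_subspace[OF S] by auto
  moreover have "continuous_on (sphere 0 1 \<inter> S) (\<lambda>x. x \<bullet> f x)"
    using f by (intro continuous_intros linear_continuous_on) (simp add: linear_conv_bounded_linear)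
  ultimately obtain v where "v \<in> sphere 0 1 \<inter> S"
    and "\<forall>x\<in>sphere 0 1 \<inter> S. x \<bullet> f x \<le> v \<bullet> f v"
    using continuous_attains_sup by blast
  then have v: "v \<in> S" "norm v = 1"
    and max: "\<And>x. x \<in> S \<Longrightarrow> norm x = 1 \<Longrightarrow> x \<bullet> f x \<le> v \<bullet> f v"
    by auto
  define \<mu> where "\<mu> = v \<bullet> f v"
  \<comment> \<open>By homogeneity the bound on unit vectors extends to all of
    \<open>S\<close>.\<close>
  have q: "x \<bullet> f x \<le> \<mu> * (x \<bullet> x)" if "x \<in> S" for x
  proof (cases "x = 0")
    case False
    let ?y = "x /\<^sub>R norm x"
    have "?y \<bullet> f ?y \<le> \<mu>" unfolding \<mu>_def
      using False that S by (intro max) (auto intro: subspace_scale)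
    also have "?y \<bullet> f ?y = (x \<bullet> f x) / (x \<bullet> x)"
      using f by (simp add: linear_scale dot_square_norm power2_eq_square field_simps)
    finally show ?thesis using False by (simp add: field_simps)
  qed (use f in \<open>simp add: linear_0\<close>)
  define w where "w = \<mu> *\<^sub>R v - f v"
  have w: "w \<in> S" unfolding w_def using v inv S by (auto intro: subspace_diff subspace_scale)
  define r where "r = \<mu> * (w \<bullet> w) - w \<bullet> f w"
  have vv: "v \<bullet> v = 1" using v by (simp add: dot_square_norm)
  \<comment> \<open>The bound \<open>q\<close> at \<open>v + t *\<^sub>R w\<close>, expanded in
    \<open>t\<close>: the constant term vanishes by the choice of \<open>\<mu>\<close>, and
    self-adjointness merges the cross terms into \<open>2 * t * (w \<bullet> w)\<close>.\<close>
  have pos: "0 \<le> t\<^sup>2 * r + 2 * t * (w \<bullet> w)" for t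
  proof -
    have "v + t *\<^sub>R w \<in> S" using v w S by (auto intro: subspace_add subspace_scale)
    from q[OF this] have "0 \<le> \<mu> * ((v + t *\<^sub>R w) \<bullet> (v + t *\<^sub>R w)) - (v + t *\<^sub>R w) \<bullet> f (v + t *\<^sub>R w)"
      by simp
    also have "\<dots> = t\<^sup>2 * r + 2 * t * (w \<bullet> (\<mu> *\<^sub>R v - f v)) + (\<mu> * (v \<bullet> v) - v \<bullet> f v)"
      using f sa[of v w] by (simp add: linear_add linear_scale r_def algebra_simps inner_commute power2_eq_square)
    finally show ?thesis by (simp add: vv flip: w_def \<mu>_def)
  qed
  have "r \<ge> 0" using q[OF w] by (simp add: r_def)
  have "w \<bullet> w = 0"
  proof (rule ccontr)
    assume "w \<bullet> w \<noteq> 0"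
    then have ww: "w \<bullet> w > 0" by simp
    \<comment> \<open>At \<open>t = - s\<close> with \<open>s\<close> this small, the linear term
      outweighs the quadratic one. Adding 1 keeps the denominator positive when
      \<open>r = 0\<close>.\<close>
    define s where "s = (w \<bullet> w) / (r + 1)"
    have s: "s > 0" "s * r \<le> w \<bullet> w" using ww \<open>r \<ge> 0\<close> by (auto simp: s_def field_simps)
    have "0 \<le> s * (s * r - 2 * (w \<bullet> w))" using pos[of "- s"] by (simp add: algebra_simps power2_eq_square)
    then have "2 * (w \<bullet> w) \<le> s * r" using s by (simp add: zero_le_mult_iff)
    with s ww show False by linarith
  qed
  then have "f v = \<mu> *\<^sub>R v" by (simp add: w_def)
  with v that show ?thesis by blast
qed

text \<open>Induction on the dimension: split off a unit eigenvector \<open>v\<close> and continue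
  in its orthogonal complement within \<open>S\<close>, which is invariant because
  \<open>v \<bullet> f y = f v \<bullet> y = \<mu> * (v \<bullet> y)\<close>.\<close>

lemma selfadjoint_eigenbasis_subspace:
  fixes f :: "'a::euclidean_space \<Rightarrow> 'a"
  assumes f: "linear f" and sa: "\<And>x y. f x \<bullet> y = x \<bullet> f y"
    and "subspace S" and "\<And>x. x \<in> S \<Longrightarrow> f x \<in> S"
  shows "\<exists>B l. finite B \<and> pairwise orthogonal B \<and> (\<forall>b\<in>B. norm b = 1 \<and> f b = l b *\<^sub>R b) \<and>
    B \<subseteq> S \<and> S \<subseteq> span B"
  using assms(3,4)
proof (induction "dim S" arbitrary: S rule: less_induct)
  case less
  note S = \<open>subspace S\<close> and inv = less.prems(2)
  show ?case
  proof (cases "S = {0}")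
    case True
    then show ?thesis by (intro exI[of _ "{}"]) auto
  next
    case False
    obtain v \<mu> where v: "v \<in> S" "norm v = 1" "f v = \<mu> *\<^sub>R v"
      using selfadjoint_eigenvector[OF f sa S inv False] by metis
    have vv: "v \<bullet> v = 1" using v by (simp add: dot_square_norm)
    define T where "T = S \<inter> {y. v \<bullet> y = 0}"
    have T: "subspace T" unfolding T_def using S subspace_hyperplane by (rule subspace_inter)
    have "v \<notin> T" using vv by (simp add: T_def)
    moreover have "T \<subseteq> S" by (simp add: T_def)
    ultimately have "T \<subset> S" using v by blast
    then have "dim T < dim S" using S T by (metis dim_psubset span_eq_iff)
    moreover have "f y \<in> T" if "y \<in> T" for y
      using that inv v(3) sa[of v y] by (auto simp: T_def)
    ultimately obtain B l where B: "finite B" "pairwise orthogonal B"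
      "\<And>b. b \<in> B \<Longrightarrow> norm b = 1 \<and> f b = l b *\<^sub>R b" "B \<subseteq> T" "T \<subseteq> span B"
      using less.hyps[OF _ T] by metis
    \<comment> \<open>Hence updating \<open>l\<close> at \<open>v\<close> leaves the eigenvalues on
      \<open>B\<close> unchanged.\<close>
    have vB: "v \<notin> B" using B(4) \<open>v \<notin> T\<close> by blast
    have "S \<subseteq> span (insert v B)"
    proof
      fix x assume "x \<in> S"
      then have "x - (v \<bullet> x) *\<^sub>R v \<in> T" using v S vv
        by (auto simp: T_def algebra_simps intro: subspace_diff subspace_scale)
      then show "x \<in> span (insert v B)" using B(5) by (auto simp: span_insert)
    qed
    moreover have "pairwise orthogonal (insert v B)"
      using B(2,4) by (auto simp: pairwise_insert T_def orthogonal_def inner_commute)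
    moreover have "\<forall>b\<in>insert v B. norm b = 1 \<and> f b = (l(v := \<mu>)) b *\<^sub>R b"
      using B(3) v vB by auto
    moreover have "insert v B \<subseteq> S" using v B(4) by (auto simp: T_def)
    ultimately show ?thesis using B(1)
      by (intro exI[of _ "insert v B"] exI[of _ "l(v := \<mu>)"]) auto
  qed
qed

section \<open>Symmetric matrices and their functional calculus\<close>

lemma symmetric_matrix_inner:
  fixes A :: "real^'n^'n"
  assumes "transpose A = A"
  shows "(A *v x) \<bullet> y = x \<bullet> (A *v y)"
  by (metis assms dot_lmul_matrix transpose_matrix_vector)

lemma symmetric_matrix_eigenbasis:
  fixes A :: "real^'n^'n"
  assumes "transpose A = A"
  obtains B l where "finite B" "\<And>b c. b \<in> B \<Longrightarrow> c \<in> B \<Longrightarrow> b \<bullet> c = (if b = c then 1 else 0)"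
    "\<And>b. b \<in> B \<Longrightarrow> A *v b = l b *\<^sub>R b" "span B = UNIV"
proof -
  obtain B l where B: "finite B" "pairwise orthogonal B"
      "\<forall>b\<in>B. norm b = 1 \<and> A *v b = l b *\<^sub>R b" "UNIV \<subseteq> span B"
    using selfadjoint_eigenbasis_subspace[of "(*v) A" UNIV] symmetric_matrix_inner[OF assms]
    by auto
  show thesis
  proof (rule that[of B l])
    show "b \<bullet> c = (if b = c then 1 else 0)" if "b \<in> B" "c \<in> B" for b c
      using B that by (auto simp: pairwise_def orthogonal_def dot_square_norm)
  qed (use B in auto)
qed

lemma matrix_eq_on_span:
  fixes A B :: "real^'n^'m"
  assumes "\<And>b. b \<in> S \<Longrightarrow> A *v b = B *v b" "span S = UNIV"
  shows "A = B"
  using linear_eq_on_span[of "(*v) A" "(*v) B" S] assms by (auto simp: matrix_eq)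

text \<open>Functional calculus: \<open>F g\<close> is \<open>g\<close> applied to the spectrum of \<open>A\<close>.\<close>

lemma functional_calculus:
  fixes A :: "real^'n^'n"
  assumes A: "nonneg_definite A"
  obtains F :: "(real \<Rightarrow> real) \<Rightarrow> real^'n^'n" where
    "F (\<lambda>x. x) = A"
    "\<And>g h. F g ** F h = F (\<lambda>x. g x * h x)"
    "\<And>g h. (\<And>x. x \<ge> 0 \<Longrightarrow> g x = h x) \<Longrightarrow> F g = F h"
    "\<And>g. transpose (F g) = F g"
    "\<And>g. (\<And>x. x \<ge> 0 \<Longrightarrow> g x \<ge> 0) \<Longrightarrow> nonneg_definite (F g)"
proof -
  obtain B l where B: "finite B" "\<And>b c. b \<in> B \<Longrightarrow> c \<in> B \<Longrightarrow> b \<bullet> c = (if b = c then 1 else 0)"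
    "\<And>b. b \<in> B \<Longrightarrow> A *v b = l b *\<^sub>R b" "span B = UNIV"
    using A symmetric_matrix_eigenbasis unfolding nonneg_definite_def by metis
  have l: "l b \<ge> 0" if "b \<in> B" for b
  proof -
    have "0 \<le> b \<bullet> (A *v b)" using A by (simp add: nonneg_definite_def)
    then show ?thesis using B(2,3) that by simp
  qed
  \<comment> \<open>The spectral sum of \<open>g (l b)\<close> times the projector on the line of
    \<open>b\<close>. All \<open>l b\<close> are nonnegative, so only the values of \<open>g\<close>
    on nonnegative arguments matter.\<close>
  define F :: "(real \<Rightarrow> real) \<Rightarrow> real^'n^'n"
    where "F g = matrix (\<lambda>x. \<Sum>b\<in>B. (g (l b) * (b \<bullet> x)) *\<^sub>R b)" for g
  have F: "F g *v x = (\<Sum>b\<in>B. (g (l b) * (b \<bullet> x)) *\<^sub>R b)" for g x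
  proof -
    have "linear (\<lambda>x. \<Sum>b\<in>B. (g (l b) * (b \<bullet> x)) *\<^sub>R b)"
      by (intro linear_compose_sum ballI linearI) (auto simp: algebra_simps)
    then show ?thesis by (simp add: F_def matrix_works)
  qed
  have Fb: "F g *v c = g (l c) *\<^sub>R c" if c: "c \<in> B" for g c
  proof -
    have "F g *v c = (\<Sum>b\<in>B. if b = c then g (l b) *\<^sub>R b else 0)"
      unfolding F using B(2) c by (intro sum.cong) auto
    then show ?thesis using B(1) c by simp
  qed
  \<comment> \<open>This expression is symmetric in \<open>x\<close> and \<open>y\<close>, whence
    the symmetry of \<open>F g\<close>.\<close>
  have Fi: "y \<bullet> (F g *v x) = (\<Sum>b\<in>B. g (l b) * (b \<bullet> x) * (b \<bullet> y))" for g x y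
    by (simp add: F inner_sum_right inner_commute)
  have Ft: "transpose (F g) = F g" for g
  proof -
    have "y \<bullet> (transpose (F g) *v x) = x \<bullet> (F g *v y)" for x y
      by (simp add: dot_lmul_matrix inner_commute[of y])
    then have "y \<bullet> (transpose (F g) *v x) = y \<bullet> (F g *v x)" for x y
      by (simp only: Fi mult_ac)
    then show ?thesis by (metis matrix_eq vector_eq_ldot)
  qed
  show thesis
  proof (rule that[of F])
    show "F (\<lambda>x. x) = A" using B Fb by (intro matrix_eq_on_span[of B]) auto
    show "F g ** F h = F (\<lambda>x. g x * h x)" for g h
      using B(4) Fb by (intro matrix_eq_on_span[of B])
        (auto simp: matrix_vector_mult_scaleR simp flip: matrix_vector_mul_assoc)
    show "F g = F h" if "\<And>x. x \<ge> 0 \<Longrightarrow> g x = h x" for g h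
      using B(4) Fb l that by (intro matrix_eq_on_span[of B]) auto
    show "nonneg_definite (F g)" if "\<And>x. x \<ge> 0 \<Longrightarrow> g x \<ge> 0" for g
      unfolding nonneg_definite_def using l that by (auto simp: Ft Fi mult.assoc intro!: sum_nonneg)
  qed (rule Ft)
qed

section \<open>Square roots and Moore--Penrose inverses\<close>

text \<open>The two roots are compared on an orthonormal eigenbasis of \<open>T\<close>, where
  \<open>S ** S\<close> acts as \<open>(l b)\<^sup>2\<close>.\<close>

lemma nnd_square_root_unique:
  fixes S T :: "real^'n^'n"
  assumes S: "nonneg_definite S" and T: "nonneg_definite T" and eq: "S ** S = T ** T"
  shows "S = T"
proof -
  have sS: "transpose S = S" and sT: "transpose T = T"
    using S T by (auto simp: nonneg_definite_def)
  obtain B l where B: "\<And>b c. b \<in> B \<Longrightarrow> c \<in> B \<Longrightarrow> b \<bullet> c = (if b = c then 1 else 0)"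
    "\<And>b. b \<in> B \<Longrightarrow> T *v b = l b *\<^sub>R b" "span B = UNIV"
    using symmetric_matrix_eigenbasis[OF sT] by metis
  have "S *v b = T *v b" if b: "b \<in> B" for b
  proof -
    have l: "l b \<ge> 0"
      using T B(1,2) b by (auto simp: nonneg_definite_def dest!: spec[of _ b])
    have SS: "S *v (S *v b) = (l b)\<^sup>2 *\<^sub>R b"
    proof -
      have "S *v (S *v b) = T *v (T *v b)" by (simp add: matrix_vector_mul_assoc eq)
      then show ?thesis using B(2)[OF b] by (simp add: matrix_vector_mult_scaleR power2_eq_square)
    qed
    show ?thesis
    proof (cases "l b = 0")
      case True
      \<comment> \<open>By symmetry the squared norm of \<open>S *v b\<close> is
        \<open>b \<bullet> (S *v (S *v b))\<close>, which is zero here.\<close>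
      then have "(S *v b) \<bullet> (S *v b) = 0"
        using SS symmetric_matrix_inner[OF sS, of b "S *v b"] by simp
      then show ?thesis using True B(2)[OF b] by simp
    next
      case False
      \<comment> \<open>\<open>(S + l) w = (S\<^sup>2 - l\<^sup>2) b = 0\<close> while \<open>S + l\<close> is positive definite.\<close>
      define w where "w = S *v b - l b *\<^sub>R b"
      have "S *v w = - (l b *\<^sub>R w)"
        by (simp add: w_def matrix_vector_mult_diff_distrib matrix_vector_mult_scaleR SS
            algebra_simps power2_eq_square)
      moreover have "0 \<le> w \<bullet> (S *v w)" using S by (simp add: nonneg_definite_def)
      ultimately have "l b * (w \<bullet> w) \<le> 0" by simp
      then have "w \<bullet> w \<le> 0" using False l by (simp add: mult_le_0_iff)
      then have "w = 0" by (metis inner_eq_zero_iff inner_ge_zero order_antisym)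
      then show ?thesis using B(2)[OF b] by (simp add: w_def)
    qed
  qed
  then show ?thesis using B(3) by (intro matrix_eq_on_span[of B])
qed

lemma nnd_sqrt_eqI: "nonneg_definite S \<Longrightarrow> S ** S = A \<Longrightarrow> nnd_sqrt A = S"
  unfolding nnd_sqrt_def by (rule the_equality) (auto intro: nnd_square_root_unique)

lemma pos_definite_imp_nonneg_definite: "pos_definite A \<Longrightarrow> nonneg_definite A"
  unfolding pos_definite_def nonneg_definite_def by (metis inner_zero_left less_imp_le order_refl)

text \<open>With \<open>F sqrt\<close> as the root of \<open>S\<close>, the form
  \<open>x \<bullet> (S *v x)\<close> is the squared norm of \<open>F sqrt *v x\<close>, and that
  vector vanishes only if \<open>S *v x = 0\<close>.\<close>

lemma nonneg_definite_invertible_imp_pos_definite: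
  fixes S :: "real^'n^'n"
  assumes S: "nonneg_definite S" and inj: "\<And>x. S *v x = 0 \<Longrightarrow> x = 0"
  shows "pos_definite S"
proof -
  obtain F :: "(real \<Rightarrow> real) \<Rightarrow> real^'n^'n" where F: "F (\<lambda>x. x) = S" "\<And>g h. F g ** F h = F (\<lambda>x. g x * h x)"
    "\<And>g h. (\<And>x. x \<ge> 0 \<Longrightarrow> g x = h x) \<Longrightarrow> F g = F h" "\<And>g. transpose (F g) = F g"
    by (rule functional_calculus[OF S]) blast
  have "F sqrt ** F sqrt = F (\<lambda>x. x)" unfolding F(2) by (rule F(3)) simp
  then have S': "F sqrt *v (F sqrt *v x) = S *v x" for x
    using F(1) by (simp add: matrix_vector_mul_assoc)
  have "0 < x \<bullet> (S *v x)" if "x \<noteq> 0" for x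
  proof -
    have "F sqrt *v x \<noteq> 0" using S'[of x] inj that by force
    moreover have "x \<bullet> (S *v x) = (F sqrt *v x) \<bullet> (F sqrt *v x)"
      using symmetric_matrix_inner[OF F(4)] S' by metis
    ultimately show ?thesis by simp
  qed
  then show ?thesis using S by (simp add: pos_definite_def nonneg_definite_def)
qed

text \<open>The root from the functional calculus has trivial kernel because \<open>W\<close> has,
  so it is positive definite; uniqueness among nonnegative definite roots identifies it with
  \<open>pd_sqrt W\<close>.\<close>

lemma pd_sqrt:
  fixes W :: "real^'n^'n"
  assumes W: "pos_definite W"
  shows "pos_definite (pd_sqrt W)" "pd_sqrt W ** pd_sqrt W = W"
proof -
  obtain F :: "(real \<Rightarrow> real) \<Rightarrow> real^'n^'n" where F: "F (\<lambda>x. x) = W" "\<And>g h. F g ** F h = F (\<lambda>x. g x * h x)"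
    "\<And>g h. (\<And>x. x \<ge> 0 \<Longrightarrow> g x = h x) \<Longrightarrow> F g = F h"
    "\<And>g. (\<And>x. x \<ge> 0 \<Longrightarrow> g x \<ge> 0) \<Longrightarrow> nonneg_definite (F g)"
    by (rule functional_calculus[OF pos_definite_imp_nonneg_definite[OF W]]) blast
  have sq: "F sqrt ** F sqrt = W" unfolding F(2) F(1)[symmetric] by (rule F(3)) simp
  have "x = 0" if "F sqrt *v x = 0" for x
  proof (rule ccontr)
    assume "x \<noteq> 0"
    moreover have "W *v x = 0" using that sq by (metis matrix_vector_mul_assoc matrix_vector_mult_0_right)
    ultimately show False using W unfolding pos_definite_def by force
  qed
  then have pd: "pos_definite (F sqrt)"
    by (intro nonneg_definite_invertible_imp_pos_definite F(4)) auto
  have "pd_sqrt W = F sqrt" unfolding pd_sqrt_def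
    using pd sq by (intro the_equality)
      (auto intro: nnd_square_root_unique pos_definite_imp_nonneg_definite)
  then show "pos_definite (pd_sqrt W)" "pd_sqrt W ** pd_sqrt W = W" using pd sq by simp_all
qed

section \<open>Inverses of positive definite matrices\<close>

lemma pos_definite_invertible:
  fixes W :: "real^'n^'n"
  assumes "pos_definite W"
  shows "invertible W"
  unfolding invertible_left_inverse matrix_left_invertible_ker
  using assms unfolding pos_definite_def by force

lemma invertible_matrix_inv:
  fixes A :: "real^'n^'n"
  assumes "invertible A"
  shows "A ** matrix_inv A = mat 1" "matrix_inv A ** A = mat 1"
  using someI_ex[OF assms[unfolded invertible_def]] unfolding matrix_inv_def by auto

text \<open>Substituting \<open>x = W *v y\<close> turns the quadratic form of the inverse at
  \<open>x\<close> into that of \<open>W\<close> at \<open>y\<close>.\<close>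

lemma pos_definite_matrix_inv:
  fixes W :: "real^'n^'n"
  assumes W: "pos_definite W"
  shows "pos_definite (matrix_inv W)"
proof -
  note I = invertible_matrix_inv[OF pos_definite_invertible[OF W]]
  have sW: "transpose W = W" using W by (simp add: pos_definite_def)
  have "transpose (matrix_inv W) ** W = mat 1"
    using arg_cong[OF I(1), of transpose] by (simp add: matrix_transpose_mul sW)
  then have "transpose (matrix_inv W) = matrix_inv W"
    using I by (metis matrix_mul_assoc matrix_mul_lid matrix_mul_rid)
  moreover have "0 < x \<bullet> (matrix_inv W *v x)" if "x \<noteq> 0" for x
  proof -
    let ?y = "matrix_inv W *v x"
    have x: "x = W *v ?y" by (simp add: matrix_vector_mul_assoc I)
    then have "?y \<noteq> 0" using that by force
    then have "0 < ?y \<bullet> (W *v ?y)" using W by (simp add: pos_definite_def)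
    then show ?thesis by (simp add: inner_commute flip: x)
  qed
  ultimately show ?thesis by (simp add: pos_definite_def)
qed

lemma inv_sqrt_square:
  fixes W :: "real^'n^'n"
  assumes W: "pos_definite W"
  shows "inv_sqrt W ** inv_sqrt W = matrix_inv W"
proof -
  let ?V = "pd_sqrt W" and ?U = "inv_sqrt W"
  have "invertible ?V" using pos_definite_invertible pd_sqrt(1)[OF W] by blast
  then have UV: "?U ** ?V = mat 1"
    by (simp add: inv_sqrt_def invertible_matrix_inv)
  have "?U ** ?U ** W = ?U ** ?U ** (?V ** ?V)" by (simp only: pd_sqrt(2)[OF W])
  also have "\<dots> = ?U ** (?U ** ?V) ** ?V" by (simp only: matrix_mul_assoc)
  also have "\<dots> = mat 1" by (simp add: UV)
  finally have "?U ** ?U ** W = mat 1" .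
  then show ?thesis using invertible_matrix_inv(1)[OF pos_definite_invertible[OF W]]
    by (metis matrix_mul_assoc matrix_mul_lid matrix_mul_rid)
qed

section \<open>Moore-Penrose inverses\<close>

text \<open>\<open>A ** G\<close> and \<open>A ** H\<close> absorb each other, and transposing a
  product of symmetric matrices reverses it, so the two coincide; likewise
  \<open>G ** A = H ** A\<close>. Then \<open>G = G ** A ** G = H ** A ** H = H\<close>.\<close>

lemma is_pinv_unique:
  fixes A :: "real^'n^'m"
  assumes G: "is_pinv A G" and H: "is_pinv A H"
  shows "G = H"
proof -
  have g: "A ** G ** A = A" "G ** A ** G = G" "transpose (A ** G) = A ** G" "transpose (G ** A) = G ** A"
    and h: "A ** H ** A = A" "H ** A ** H = H" "transpose (A ** H) = A ** H" "transpose (H ** A) = H ** A"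
    using G H by (auto simp: is_pinv_def)
  have "A ** G = transpose ((A ** H) ** (A ** G))" by (simp add: h g matrix_mul_assoc)
  also have "\<dots> = (A ** G) ** (A ** H)"
    by (simp only: matrix_transpose_mul[of "A ** H"] g h)
  also have "\<dots> = A ** H" by (simp add: matrix_mul_assoc g)
  finally have AG: "A ** G = A ** H" .
  have "G ** A = transpose ((G ** A) ** (H ** A))" by (simp add: h g flip: matrix_mul_assoc)
    (simp add: h g matrix_mul_assoc)
  also have "\<dots> = (H ** A) ** (G ** A)"
    by (simp only: matrix_transpose_mul[of "G ** A"] g h)
  also have "\<dots> = H ** (A ** G ** A)" by (simp add: matrix_mul_assoc)
  finally have GA: "G ** A = H ** A" by (simp add: g)
  have "G = G ** (A ** G)" using g(2) by (simp add: matrix_mul_assoc)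
  also have "\<dots> = H ** A ** H" by (simp add: AG GA matrix_mul_assoc)
  finally show ?thesis by (simp add: h)
qed

lemma pinv_eqI: "is_pinv A G \<Longrightarrow> pinv A = G"
  unfolding pinv_def by (rule the_equality) (auto intro: is_pinv_unique)

text \<open>\<open>M\<close>, its root and \<open>pinv_sqrt M\<close> are all functions of
  \<open>M\<close>, so each relation reduces to a scalar identity on the nonnegative reals.\<close>

lemma pinv_sqrt:
  fixes M :: "real^'n^'n"
  assumes M: "nonneg_definite M"
  obtains S where "transpose S = S" "S ** S = M" "transpose (pinv_sqrt M) = pinv_sqrt M"
    "pinv_sqrt M ** S = S ** pinv_sqrt M" "S ** pinv_sqrt M ** S = S"
    "pinv_sqrt M ** S ** pinv_sqrt M = pinv_sqrt M"
proof -
  obtain F :: "(real \<Rightarrow> real) \<Rightarrow> real^'n^'n" where F: "F (\<lambda>x. x) = M" "\<And>g h. F g ** F h = F (\<lambda>x. g x * h x)"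
    "\<And>g h. (\<And>x. x \<ge> 0 \<Longrightarrow> g x = h x) \<Longrightarrow> F g = F h" "\<And>g. transpose (F g) = F g"
    "\<And>g. (\<And>x. x \<ge> 0 \<Longrightarrow> g x \<ge> 0) \<Longrightarrow> nonneg_definite (F g)"
    by (rule functional_calculus[OF M]) blast
  \<comment> \<open>The convention \<open>inverse 0 = 0\<close> makes \<open>F inverse\<close> the
    Moore-Penrose inverse and \<open>F r\<close> its root even when \<open>M\<close> is
    singular.\<close>
  define r where "r = (\<lambda>x. inverse (sqrt x))"
  have "is_pinv M (F inverse)"
    unfolding is_pinv_def F(1)[symmetric] F(2) F(4)
    by (intro conjI F(3)) (auto simp: divide_simps)
  moreover have "F r ** F r = F inverse" unfolding F(2)
    by (rule F(3)) (simp add: r_def flip: inverse_mult_distrib)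
  moreover have "nonneg_definite (F r)" by (rule F(5)) (simp add: r_def)
  ultimately have R: "pinv_sqrt M = F r"
    unfolding pinv_sqrt_def by (simp add: pinv_eqI nnd_sqrt_eqI)
  show thesis
  proof (rule that[of "F sqrt"])
    show "F sqrt ** F sqrt = M" unfolding F(2) F(1)[symmetric] by (rule F(3)) simp
  qed (unfold R F(2) F(4), (rule F(3), simp add: r_def divide_simps)+)
qed

section \<open>Characteristic polynomials of products\<close>

lemma poly_charpoly:
  fixes A :: "real^'n^'n"
  shows "poly (charpoly A) x = det (x *\<^sub>R mat 1 - A)"
proof -
  have "poly ((mat [:0, 1:] - (\<chi> i j. [:A $ i $ j:])) $ i $ j) x = (x *\<^sub>R mat 1 - A) $ i $ j" for i j
    by (simp add: mat_def)
  then show ?thesis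
    by (simp add: charpoly_def det_def poly_sum poly_prod del: vector_minus_component)
qed

text \<open>The set consists of the real roots of \<open>charpoly A\<close>, a nonzero polynomial:
  with \<open>K\<close> bounding the operator norm, \<open>K + 1\<close> is not an
  eigenvalue.\<close>

lemma finite_singular_shift:
  fixes A :: "real^'n^'n"
  shows "finite {x. det (x *\<^sub>R mat 1 - A) = 0}"
proof -
  obtain K where K: "\<And>v. norm (A *v v) \<le> norm v * K" "K > 0"
    using bounded_linear.pos_bounded[OF matrix_vector_mul_bounded_linear[of A]] by blast
  have "invertible ((K + 1) *\<^sub>R mat 1 - A)"
    unfolding invertible_left_inverse matrix_left_invertible_ker
  proof (intro allI impI)
    fix v assume "((K + 1) *\<^sub>R mat 1 - A) *v v = 0"
    then have "A *v v = (K + 1) *\<^sub>R v"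
      by (simp add: matrix_vector_mult_diff_rdistrib flip: scaleR_matrix_vector_assoc)
    with K(1)[of v] K(2) have "(K + 1) * norm v \<le> norm v * K" by simp
    then show "v = 0" by (simp add: algebra_simps)
  qed
  then have "poly (charpoly A) (K + 1) \<noteq> 0" by (simp add: poly_charpoly invertible_det_nz)
  then have "charpoly A \<noteq> 0" by force
  from poly_roots_finite[OF this] show ?thesis by (simp add: poly_charpoly)
qed

lemma continuous_det:
  fixes f :: "'a::topological_space \<Rightarrow> real^'n^'n"
  assumes "\<And>i j. continuous_on S (\<lambda>x. f x $ i $ j)"
  shows "continuous_on S (\<lambda>x. det (f x))"
  unfolding det_def by (intro continuous_intros assms)

lemma charpoly_mult_commute:
  fixes A B :: "real^'n^'n"
  shows "charpoly (A ** B) = charpoly (B ** A)"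
proof -
  have "det (x *\<^sub>R mat 1 - A ** B) = det (x *\<^sub>R mat 1 - B ** A)" for x
  proof -
    \<comment> \<open>Perturb \<open>A\<close> to \<open>A + t I\<close>, which is invertible for all but finitely many \<open>t\<close>, and let \<open>t\<close> tend to 0.\<close>
    define At where "At t = t *\<^sub>R mat 1 - (- A)" for t
    define h where "h t = det (x *\<^sub>R mat 1 - At t ** B) - det (x *\<^sub>R mat 1 - B ** At t)" for t
    have h0: "h t = 0" if "det (At t) \<noteq> 0" for t
    proof -
      have "invertible (At t)" using that by (simp add: invertible_det_nz)
      then have I: "At t ** matrix_inv (At t) = mat 1" by (rule invertible_matrix_inv)
      \<comment> \<open>Both sides equal \<open>x *\<^sub>R At t - At t ** B ** At t\<close>; after
        taking determinants the nonzero factor \<open>det (At t)\<close> cancels.\<close>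
      have e: "(x *\<^sub>R mat 1 - At t ** B) ** At t = At t ** (x *\<^sub>R mat 1 - B ** At t)"
        by (simp add: matrix_mul_assoc matrix_eq matrix_vector_mult_diff_rdistrib
            matrix_vector_mult_diff_distrib matrix_vector_mult_scaleR
            flip: matrix_vector_mul_assoc scaleR_matrix_vector_assoc)
      show ?thesis using arg_cong[OF e, of det] that by (simp add: det_mul h_def)
    qed
    have "continuous_on UNIV h" unfolding h_def At_def matrix_matrix_mult_def
      by (intro continuous_intros continuous_det)
    then have "(h \<longlongrightarrow> h 0) (at 0)"
      by (simp add: continuous_on_eq_continuous_at isCont_def)
    moreover have "(h \<longlongrightarrow> 0) (at 0)"
    proof (rule tendsto_eventually)
      have "finite {t. det (At t) = 0}" unfolding At_def by (rule finite_singular_shift)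
      \<comment> \<open>A finite set has no limit point, so a punctured neighbourhood of 0 avoids
        it.\<close>
      then have "\<forall>\<^sub>F t in at 0. t \<notin> {t. det (At t) = 0}"
        by (metis (no_types, lifting) islimpt_finite islimpt_iff_eventually eventually_mono)
      then show "\<forall>\<^sub>F t in at 0. h t = 0" by (rule eventually_mono) (simp add: h0)
    qed
    ultimately have "h 0 = 0" using tendsto_unique[of "at 0"] by force
    then show ?thesis by (simp add: h_def At_def)
  qed
  then have "poly (charpoly (A ** B)) = poly (charpoly (B ** A))" by (simp add: poly_charpoly fun_eq_iff)
  then show ?thesis by (simp add: poly_eq_poly_eq_iff)
qed

section \<open>The two information matrices\<close>

lemma orth_proj_idem_symmetric:
  fixes S :: "(real^'n) set"
  assumes S: "subspace S"
  shows "x \<in> S \<Longrightarrow> orth_proj S *v x = x" "orth_proj S *v x \<in> S"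
    "transpose (orth_proj S) = orth_proj S"
proof -
  let ?P = "orth_proj S"
  have P: "\<And>x. ?P *v x \<in> S" "\<And>x y. y \<in> S \<Longrightarrow> (x - ?P *v x) \<bullet> y = 0"
    using is_orth_proj_orth_proj[OF S] by (auto simp: is_orth_proj_def orthogonal_def)
  show "?P *v x \<in> S" by (rule P)
  show "?P *v x = x" if "x \<in> S"
    using P(2)[OF subspace_diff[OF S that P(1)[of x]], of x] by simp
  \<comment> \<open>Residuals are orthogonal to \<open>S\<close>, so both sides equal
    \<open>(?P *v x) \<bullet> (?P *v y)\<close>.\<close>
  have "(?P *v x) \<bullet> y = x \<bullet> (?P *v y)" for x y
    using P(2)[OF P(1)[of x], of y] P(2)[OF P(1)[of y], of x]
    by (simp add: inner_diff_left inner_diff_right inner_commute)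
  then have "y \<bullet> (transpose ?P *v x) = y \<bullet> (?P *v x)" for x y
    by (metis dot_lmul_matrix inner_commute transpose_matrix_vector)
  then show "transpose ?P = ?P" by (metis matrix_eq vector_eq_ldot)
qed

lemma transpose_info_matrix: "transpose (info_matrix X L) = info_matrix X L"
proof -
  have "transpose (mat 1 - orth_proj (col_space L)) = mat 1 - orth_proj (col_space L)"
    using orth_proj_idem_symmetric(3)[of "col_space L"]
    by (simp add: col_space_def transpose_def vec_eq_iff mat_def)
  then show ?thesis by (simp add: info_matrix_def matrix_transpose_mul matrix_mul_assoc)
qed

text \<open>This turns feasibility into a matrix equation: the columns of \<open>K\<close> are
  chosen preimages under \<open>B\<close> of the columns of \<open>A\<close>.\<close>

lemma col_space_subset_factor:
  fixes A :: "real^'n^'m" and B :: "real^'k^'m"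
  assumes "col_space A \<subseteq> col_space B"
  obtains K where "A = B ** K"
proof -
  have "\<exists>k. A *v axis j 1 = B *v k" for j
    using assms unfolding col_space_eq_range by blast
  then obtain k where k: "\<And>j. A *v axis j 1 = B *v k j" by metis
  define K where "K = (\<chi> i j. k j $ i)"
  have "K *v axis j 1 = k j" for j
    by (simp add: K_def matrix_vector_mult_basis column_def vec_eq_iff)
  then have "(B ** K) *v axis j 1 = A *v axis j 1" for j
    by (simp add: k flip: matrix_vector_mul_assoc)
  then have "column j (B ** K) = column j A" for j by (simp add: matrix_vector_mult_basis)
  then have "A = B ** K" by (simp add: vec_eq_iff column_def)
  then show thesis by (rule that)
qed

text \<open>\<open>S ** R\<close> is the projector belonging to \<open>M = P ** V ** P\<close>.
  Positive definiteness of \<open>V\<close> gives \<open>M\<close> the same kernel as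
  \<open>P\<close>, so this projector is \<open>P\<close> itself and \<open>R\<close> inverts
  \<open>S\<close> on the range of \<open>P\<close>.\<close>

lemma pinv_sqrt_compression:
  fixes V P :: "real^'n^'n"
  assumes V: "pos_definite V" and P: "transpose P = P" "P ** P = P"
  obtains S where "transpose S = S" "S ** S = P ** V ** P"
    "transpose (pinv_sqrt (P ** V ** P)) = pinv_sqrt (P ** V ** P)"
    "S ** pinv_sqrt (P ** V ** P) = P" "pinv_sqrt (P ** V ** P) ** S = P" "P ** S = S"
    "P ** pinv_sqrt (P ** V ** P) = pinv_sqrt (P ** V ** P)"
proof -
  define M where "M = P ** V ** P"
  have V': "transpose V = V" "\<And>x. 0 \<le> x \<bullet> (V *v x)"
    using pos_definite_imp_nonneg_definite[OF V] by (auto simp: nonneg_definite_def)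
  have xM: "x \<bullet> (M *v x) = (P *v x) \<bullet> (V *v (P *v x))" for x
    using symmetric_matrix_inner[OF P(1)]
    by (simp add: M_def flip: matrix_vector_mul_assoc)
  have "nonneg_definite M" unfolding nonneg_definite_def
  proof
    show "transpose M = M" by (simp add: M_def matrix_transpose_mul P V' matrix_mul_assoc)
  qed (simp add: xM V')
  then obtain S where S: "transpose S = S" "S ** S = M" "transpose (pinv_sqrt M) = pinv_sqrt M"
    "pinv_sqrt M ** S = S ** pinv_sqrt M" "S ** pinv_sqrt M ** S = S"
    "pinv_sqrt M ** S ** pinv_sqrt M = pinv_sqrt M"
    by (rule pinv_sqrt)
  define R where "R = pinv_sqrt M"
  note S = S[folded R_def]
  have MSR: "M ** (S ** R) = M"
  proof -
    have "M ** (S ** R) = S ** (S ** R ** S)" using S(2,4) by (metis matrix_mul_assoc)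
    then show ?thesis by (simp add: S)
  qed
  \<comment> \<open>Exhibiting \<open>M\<close> as a left factor shows that \<open>P\<close> fixes
    \<open>S ** R\<close>.\<close>
  have SR: "S ** R = M ** (R ** R)"
  proof -
    have "S ** R = S ** (R ** S ** R)" by (simp only: S(6))
    also have "\<dots> = S ** (S ** R ** R)" by (simp only: S(4))
    also have "\<dots> = M ** (R ** R)" by (simp add: matrix_mul_assoc flip: S(2))
    finally show ?thesis .
  qed
  have MP: "M ** P = M" "P ** M = M"
    using P(2) by (simp_all add: M_def matrix_mul_assoc) (metis matrix_mul_assoc)
  have PSR: "P ** (S ** R) = S ** R" by (simp add: SR matrix_mul_assoc MP)
  \<comment> \<open>\<open>M\<close> is injective on the range of \<open>P\<close>, because \<open>V\<close> is positive definite.\<close>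
  have "P *v x = (S ** R) *v x" for x
  proof -
    define y where "y = P *v x - (S ** R) *v x"
    have "M *v y = 0" by (simp add: y_def matrix_vector_mult_diff_distrib matrix_vector_mul_assoc MSR MP)
    then have "(P *v y) \<bullet> (V *v (P *v y)) = 0" using xM[of y] by simp
    moreover have "P *v y = y"
      by (simp add: y_def matrix_vector_mult_diff_distrib matrix_vector_mul_assoc P PSR)
    ultimately have "y = 0" using V unfolding pos_definite_def by force
    then show ?thesis by (simp add: y_def)
  qed
  then have P_SR: "S ** R = P" by (simp add: matrix_eq)
  show thesis
    by (rule that[folded M_def, folded R_def, of S]) (use S P_SR in auto)
qed

text \<open>Both products of the two matrices turn out to be the projector \<open>P\<close>, which
  acts as the identity on each of them; the Penrose equations follow.\<close>

lemma is_pinv_system_matrix: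
  fixes C G P R S K :: "real^'n^'n"
  assumes C: "transpose C = C" "C ** G ** C = C" "P ** C = C"
    and R: "transpose R = R" "R = C ** K"
    and S: "transpose S = S" "R ** S = P" "P ** R = R" "P ** S = S"
    and P: "transpose P = P"
  shows "is_pinv (transpose R ** G ** R) (S ** C ** S)"
proof -
  let ?A = "R ** G ** R" and ?H = "S ** C ** S"
  have RK: "R = transpose K ** C"
    using arg_cong[OF R(2), of transpose] by (simp add: R(1) C(1) matrix_transpose_mul)
  \<comment> \<open>Writing \<open>R\<close> as \<open>transpose K ** C\<close> lets
    \<open>C ** G ** C = C\<close> absorb \<open>G\<close>.\<close>
  have RGC: "R ** G ** C = R"
    by (subst (1) RK) (metis C(2) RK matrix_mul_assoc)
  have "?A = R ** G ** C ** K" using R(2) by (metis matrix_mul_assoc)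
  \<comment> \<open>This form shows the symmetry of \<open>?A\<close> even for a nonsymmetric
    \<open>G\<close>.\<close>
  then have "?A = transpose K ** C ** K" using RGC RK by simp
  then have sA: "transpose ?A = ?A"
    by (simp add: matrix_transpose_mul C(1) matrix_mul_assoc)
  have sH: "transpose ?H = ?H"
    by (simp add: matrix_transpose_mul C(1) S(1) matrix_mul_assoc)
  have "?A ** ?H = R ** G ** ((R ** S) ** C) ** S" by (simp only: matrix_mul_assoc)
  also have "\<dots> = P" by (simp add: S(2) C(3) RGC)
  finally have AH: "?A ** ?H = P" .
  \<comment> \<open>Transposing \<open>AH\<close> swaps the factors, since all three matrices are
    symmetric.\<close>
  then have HA: "?H ** ?A = P"
    using sA sH P by (metis matrix_transpose_mul)
  have "P ** ?A = ?A" "P ** ?H = ?H" using S(3,4) by (simp_all add: matrix_mul_assoc)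
  then show ?thesis
    unfolding is_pinv_def R(1) AH HA by (simp add: P)
qed

theorem theorem2:
  fixes X :: "'d \<Rightarrow> real^'v^'n" and L :: "real^'m^'n"
    and \<Xi> :: "'d set" and \<E> :: "(real^'v) set" and \<xi> :: 'd
    and W R G :: "real^'v^'v"
  assumes "subspace \<E>"
    and "\<And>\<zeta>. \<zeta> \<in> \<Xi> \<Longrightarrow> col_space (info_matrix (X \<zeta>) L) = \<E>"
    and "pos_definite W"
    and "R = pinv_sqrt (orth_proj \<E> ** matrix_inv W ** orth_proj \<E>)"
    and "\<xi> \<in> \<Xi>"
    and "feasible (info_matrix (X \<xi>) L) R"
    and "generalized_inverse (info_matrix (X \<xi>) L) G"
  shows "eigenvalues (weighted_info_matrix W (info_matrix (X \<xi>) L))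
       = eigenvalues (system_info_matrix G R)"
proof -
  define C where "C = info_matrix (X \<xi>) L"
  define P where "P = orth_proj \<E>"
  have C: "transpose C = C" unfolding C_def by (rule transpose_info_matrix)
  have CG: "C ** G ** C = C" using assms(7) by (simp add: generalized_inverse_def C_def)
  have E: "range ((*v) C) = \<E>" using assms(2,5) by (simp add: C_def flip: col_space_eq_range)
  note proj = orth_proj_idem_symmetric[OF \<open>subspace \<E>\<close>, folded P_def]
  have PP: "P ** P = P" using proj(1,2) by (simp add: matrix_eq flip: matrix_vector_mul_assoc)
  have PC: "P ** C = C" using proj(1) E by (auto simp: matrix_eq simp flip: matrix_vector_mul_assoc)
  then have CP: "C ** P = C"
    using C proj(3) by (metis matrix_transpose_mul)
  obtain K where K: "R = C ** K"
    using col_space_subset_factor assms(6) unfolding feasible_def C_def by blast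
  let ?V = "matrix_inv W"
  obtain S where S: "transpose S = S" "S ** S = P ** ?V ** P" "transpose R = R" "R ** S = P"
      "P ** S = S" "P ** R = R"
    using pinv_sqrt_compression[OF pos_definite_matrix_inv[OF \<open>pos_definite W\<close>] proj(3) PP]
    unfolding assms(4) P_def by metis
  have N: "system_info_matrix G R = S ** C ** S"
    unfolding system_info_matrix_def
    by (rule pinv_eqI is_pinv_system_matrix C CG PC S K proj(3))+
  let ?U = "inv_sqrt W"
  have "charpoly (S ** C ** S) = charpoly (C ** S ** S)"
    by (metis charpoly_mult_commute matrix_mul_assoc)
  \<comment> \<open>Here \<open>S ** S = P ** ?V ** P\<close>, and \<open>C\<close> absorbs the left
    \<open>P\<close>; the cyclic shift that follows brings the right \<open>P\<close> in front of
    \<open>C\<close>, where it is absorbed too.\<close>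
  also have "C ** S ** S = C ** ?V ** P" by (metis S(2) CP matrix_mul_assoc)
  also have "charpoly \<dots> = charpoly (P ** C ** ?V)"
    by (metis charpoly_mult_commute matrix_mul_assoc)
  also have "P ** C ** ?V = C ** ?U ** ?U"
    by (simp add: PC inv_sqrt_square[OF \<open>pos_definite W\<close>] flip: matrix_mul_assoc)
  also have "charpoly \<dots> = charpoly (?U ** C ** ?U)"
    by (metis charpoly_mult_commute matrix_mul_assoc)
  finally show ?thesis
    unfolding eigenvalues_def weighted_info_matrix_def N C_def[symmetric] by simp
qed

end
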